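(* Let $(r_k)_{k\ge 1}$ be a sequence of nonzero integers such that the set $\{r_k : k\ge 1\}$ is a Birkhoff set. Then for every sequence $(n_k)_{k\ge 1}$ of integers and every minimal dynamical system $(X,T)$, the set of $(n_k,r_k)$-moving recurrent points of $X$ is a dense $G_\delta$ subset of $X$. In particular, taking $r_k=k$: for every sequence $(n_k)_{k\ge1}$ of integers and every minimal dynamical system $(X,T)$, the set of $(n_k)$-moving recurrent points of $X$ is a dense $G_\delta$ subset of $X$.
   Context: A dynamical system $(X,T)$ consists of a nonempty compact metric space $X$, with a fixed compatible metric $d$, and a homeomorphism $T$ of $X$ onto itself. It is minimal if for every $x\in X$ the orbit $\{T^n x : n\in\mathbb{Z}\}$ is dense in $X$. For $U\subset X$ let $N(U,U)=\{n\in\mathbb{Z} : T^nU\cap U\neq\emptyset\}$. A set $L\subset\mathbb{Z}\setminus\{0\}$ is a Birkhoff set if for every minimal dynamical system $(X,T)$ and every nonempty open $U\subset X$ one has $N(U,U)\cap L\neq\emptyset$. For sequences $(n_k)_{k\ge1}$, $(r_k)_{k\ge1}$ of integers, let $\psi_{(n_k,r_k)}(x)=\inf_{k\ge1} d(T^{n_k+r_k}x,T^{n_k}x)$ and $\psi_{(n_k)}(x)=\inf_{k\ge 1} d(T^{n_k+k}x,T^{n_k}x)$. A point $x\in X$ is $(n_k,r_k)$-moving recurrent if $\psi_{(n_k,r_k)}(x)=0$, and $(n_k)$-moving recurrent if $\psi_{(n_k)}(x)=0$. *)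

theory Defs
  imports "HOL-Analysis.Analysis"
begin

(* A system lives on a carrier set X with its own metric d; T is only relevant on X. *)

locale dynamical_system = Metric_space X d
  for X :: "'a set" and d :: "'a \<Rightarrow> 'a \<Rightarrow> real" +
  fixes T :: "'a \<Rightarrow> 'a"
  assumes nonempty: "X \<noteq> {}"
    and compact: "compact_space mtopology"
    and homeo: "homeomorphic_map mtopology mtopology T"

definition iter :: "'a set \<Rightarrow> ('a \<Rightarrow> 'a) \<Rightarrow> int \<Rightarrow> 'a \<Rightarrow> 'a" where
  "iter X T n = (if 0 \<le> n then T ^^ nat n else inv_into X T ^^ nat (- n))"

locale minimal_system = dynamical_system +
  assumes minimal: "x \<in> X \<Longrightarrow> mtopology closure_of (range (\<lambda>n. iter X T n x)) = X"

definition return_times :: "'a set \<Rightarrow> ('a \<Rightarrow> 'a) \<Rightarrow> 'a set \<Rightarrow> int set" where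
  "return_times X T U = {n. iter X T n ` U \<inter> U \<noteq> {}}"

(* HOL cannot quantify over types inside a definition. Letting the carrier range over
   all subsets of the reals, with arbitrary metrics (unrelated to the usual one), loses
   nothing: a compact metric space has at most continuum many points, so every system
   is isometrically conjugate to one with such a carrier. *)

definition birkhoff_set :: "int set \<Rightarrow> bool" where
  "birkhoff_set L \<longleftrightarrow> 0 \<notin> L \<and>
     (\<forall>(X :: real set) d T U.
        minimal_system X d T \<longrightarrow> openin (Metric_space.mtopology X d) U \<longrightarrow> U \<noteq> {} \<longrightarrow>
        return_times X T U \<inter> L \<noteq> {})"

(* Sequences are indexed by k \<ge> 1; their value at 0 is ignored. *)

definition psi2 ::
  "'a set \<Rightarrow> ('a \<Rightarrow> 'a \<Rightarrow> real) \<Rightarrow> ('a \<Rightarrow> 'a) \<Rightarrow> (nat \<Rightarrow> int) \<Rightarrow> (nat \<Rightarrow> int) \<Rightarrow> 'a \<Rightarrow> real" where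
  "psi2 X d T n r x = (INF k\<in>{1..}. d (iter X T (n k + r k) x) (iter X T (n k) x))"

definition psi ::
  "'a set \<Rightarrow> ('a \<Rightarrow> 'a \<Rightarrow> real) \<Rightarrow> ('a \<Rightarrow> 'a) \<Rightarrow> (nat \<Rightarrow> int) \<Rightarrow> 'a \<Rightarrow> real" where
  "psi X d T n x = (INF k\<in>{1..}. d (iter X T (n k + int k) x) (iter X T (n k) x))"

definition moving_recurrent2 ::
  "'a set \<Rightarrow> ('a \<Rightarrow> 'a \<Rightarrow> real) \<Rightarrow> ('a \<Rightarrow> 'a) \<Rightarrow> (nat \<Rightarrow> int) \<Rightarrow> (nat \<Rightarrow> int) \<Rightarrow> 'a set" where
  "moving_recurrent2 X d T n r = {x \<in> X. psi2 X d T n r x = 0}"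

definition moving_recurrent ::
  "'a set \<Rightarrow> ('a \<Rightarrow> 'a \<Rightarrow> real) \<Rightarrow> ('a \<Rightarrow> 'a) \<Rightarrow> (nat \<Rightarrow> int) \<Rightarrow> 'a set" where
  "moving_recurrent X d T n = {x \<in> X. psi X d T n x = 0}"

definition dense_gdelta :: "'a topology \<Rightarrow> 'a set \<Rightarrow> bool" where
  "dense_gdelta Z S \<longleftrightarrow> gdelta_in Z S \<and> Z closure_of S = topspace Z"

end

theory Submission
  imports Defs
begin

(* The function psi is an infimum of continuous functions, so its zero set is the countable
   intersection of the open sets "psi < 1/m", and by Baire it is enough that these are dense.
   Given an open U, minimality and compactness yield a finite set F of times such that every
   orbit enters U at a time in F. Take V open and so small that all its translates by times in F
   have diameter < 1/m. The Birkhoff property gives y and k with y and T^(r k) y in V; with j in F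
   such that x = T^(j - n k) y lies in U, one has T^(n k) x = T^j y and the point x works.
   For r k = k the Birkhoff property is a pigeonhole argument on visit times to U. *)

section \<open>Integer iterates of a homeomorphism\<close>

context dynamical_system
begin

lemma bij_T: "bij_betw T X X"
  using homeo by (simp add: bij_betw_def homeomorphic_eq_everything_map)

lemma T_in [simp]: "x \<in> X \<Longrightarrow> T x \<in> X"
  using bij_T bij_betwE by blast

lemma inv_T_in [simp]: "x \<in> X \<Longrightarrow> inv_into X T x \<in> X"
  by (metis bij_T bij_betw_def inv_into_into)

lemma inv_T_T [simp]: "x \<in> X \<Longrightarrow> inv_into X T (T x) = x"
  by (meson bij_T bij_betw_inv_into_left)

lemma T_inv_T [simp]: "x \<in> X \<Longrightarrow> T (inv_into X T x) = x"
  by (meson bij_T bij_betw_inv_into_right)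

lemma continuous_T: "continuous_map mtopology mtopology T"
  using homeo by (rule homeomorphic_imp_continuous_map)

lemma continuous_inv_T: "continuous_map mtopology mtopology (inv_into X T)"
proof -
  obtain g where g: "homeomorphic_maps mtopology mtopology T g"
    using homeo homeomorphic_map_maps by blast
  \<comment> \<open>The inverse supplied by \<open>homeomorphic_maps\<close> is pinned down only on
    \<open>X\<close>; agreement with \<open>inv_into X T\<close> there suffices to carry continuity
    over.\<close>
  have "g x = inv_into X T x" if "x \<in> X" for x
    using g that unfolding homeomorphic_maps_def
    by (metis T_inv_T inv_T_in topspace_mtopology)
  with g show ?thesis
    unfolding homeomorphic_maps_def by (metis continuous_map_eq topspace_mtopology)
qed

lemma iter_0 [simp]: "iter X T 0 x = x"
  by (simp add: iter_def)

lemma continuous_iter: "continuous_map mtopology mtopology (iter X T n)"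
proof -
  have "continuous_map mtopology mtopology (f ^^ k)"
    if "continuous_map mtopology mtopology f" for f k
  proof (induction k)
    case (Suc k)
    then show ?case
      using continuous_map_compose[OF Suc that] by (simp add: o_def)
  qed (simp add: id_def)
  then show ?thesis
    by (simp add: iter_def continuous_T continuous_inv_T)
qed

lemma iter_in [simp]: "x \<in> X \<Longrightarrow> iter X T n x \<in> X"
  using continuous_iter[of n] by (auto simp: continuous_map_def Pi_iff)

lemma iter_succ: "x \<in> X \<Longrightarrow> iter X T (n + 1) x = T (iter X T n x)"
proof (cases "0 \<le> n")
  case True
  then show ?thesis
    by (simp add: iter_def nat_add_distrib)
next
  case False
  assume "x \<in> X"
  \<comment> \<open>Time \<open>n\<close> takes \<open>k + 1\<close> inverse steps and time
    \<open>n + 1\<close> takes \<open>k\<close>. For \<open>k = 0\<close> the latter is time 0,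
    which falls into the forward branch of \<open>iter\<close>.\<close>
  define k where "k = nat (- n - 1)"
  have n: "n = - 1 - int k"
    using False by (simp add: k_def)
  have "nat (- n) = Suc k"
    using n by simp
  then have "iter X T n x = inv_into X T ((inv_into X T ^^ k) x)"
    using False by (simp add: iter_def)
  moreover have "iter X T (n + 1) x = (inv_into X T ^^ k) x"
    using n by (cases "k = 0") (auto simp: iter_def)
  ultimately show ?thesis
    by (metis T_inv_T \<open>x \<in> X\<close> iter_in)
qed

lemma iter_pred:
  assumes "x \<in> X"
  shows "iter X T (n - 1) x = inv_into X T (iter X T n x)"
  using iter_succ[OF assms, of "n - 1"] assms by simp

lemma iter_add:
  assumes "x \<in> X"
  shows "iter X T (m + n) x = iter X T m (iter X T n x)"
proof (induction m rule: int_induct[where k = 0])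
  case (step1 i)
  then show ?case
    using iter_succ[of x "i + n"] iter_succ[of "iter X T n x" i] assms by (simp add: ac_simps)
next
  case (step2 i)
  have "i - 1 + n = i + n - 1"
    by simp
  then show ?case
    unfolding \<open>i - 1 + n = i + n - 1\<close>
    using step2 iter_pred[of x "i + n"] iter_pred[of "iter X T n x" i] assms by simp
qed simp

lemma openin_iter_vimage:
  "openin mtopology U \<Longrightarrow> openin mtopology {x \<in> X. iter X T n x \<in> U}"
  using openin_continuous_map_preimage[OF continuous_iter] by simp

lemma openin_dist_less:
  "openin mtopology {x \<in> X. d (iter X T m x) (iter X T n x) < e}"
proof -
  have "continuous_map mtopology euclidean (\<lambda>x. mdist (metric (X, d)) (iter X T m x) (iter X T n x))"
    by (intro continuous_map_mdist) (simp_all add: continuous_iter)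
  then have "continuous_map mtopology euclidean (\<lambda>x. d (iter X T m x) (iter X T n x))"
    by simp
  from openin_continuous_map_preimage[OF this, of "{..<e}"] show ?thesis
    by simp
qed

end

section \<open>Visits of a minimal system to an open set\<close>

context minimal_system
begin

text \<open>Dense orbits all meet \<open>U\<close>, so the preimages of \<open>U\<close> under the
  iterates form an open cover of \<open>X\<close>; a finite subcover gives \<open>F\<close>.\<close>

lemma finite_visit_times:
  assumes U: "openin mtopology U" "U \<noteq> {}"
  obtains F where "finite F" "\<And>x. x \<in> X \<Longrightarrow> \<exists>j\<in>F. iter X T j x \<in> U"
proof -
  define W where "W j = {x \<in> X. iter X T j x \<in> U}" for j
  have "\<exists>j. iter X T j x \<in> U" if "x \<in> X" for x
  proof -
    obtain u where "u \<in> U" using U by blast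
    then have "u \<in> mtopology closure_of range (\<lambda>n. iter X T n x)"
      using minimal[OF that] openin_subset[OF U(1)] by auto
    then show ?thesis
      using U \<open>u \<in> U\<close> by (force simp: in_closure_of)
  qed
  then have "X \<subseteq> \<Union> (range W)"
    by (auto simp: W_def)
  moreover have "\<And>V. V \<in> range W \<Longrightarrow> openin mtopology V"
    using openin_iter_vimage[OF U(1)] by (auto simp: W_def)
  ultimately obtain \<F> where \<F>: "finite \<F>" "\<F> \<subseteq> range W" "X \<subseteq> \<Union>\<F>"
    using compact unfolding compact_space_alt topspace_mtopology by meson
  then obtain F where "finite F" "\<F> = W ` F"
    by (meson finite_subset_image)
  with \<F> show thesis
    by (intro that[of F]) (auto simp: W_def)
qed

text \<open>An orbit visits \<open>U\<close> at some time \<open>i\<close>; restarting it far enough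
  ahead forces another visit strictly later, and the time between the two is a return time.\<close>

lemma pos_return_time:
  assumes U: "openin mtopology U" "U \<noteq> {}"
  obtains k :: nat where "k \<ge> 1" "int k \<in> return_times X T U"
proof -
  obtain F where F: "finite F" "\<And>x. x \<in> X \<Longrightarrow> \<exists>j\<in>F. iter X T j x \<in> U"
    using finite_visit_times[OF U] by blast
  obtain x where x: "x \<in> X"
    using nonempty by blast
  obtain i where i: "i \<in> F" "iter X T i x \<in> U"
    using F x by blast
  \<comment> \<open>This delay makes \<open>j + m \<ge> i + 1\<close> for every \<open>j\<close> in
    \<open>F\<close>, whichever visit time occurs next.\<close>
  define m where "m = i + 1 - Min F"
  obtain j where j: "j \<in> F" "iter X T j (iter X T m x) \<in> U"
    using F x by (meson iter_in)
  have "Min F \<le> j"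
    using F j by simp
  then have pos: "j + m - i \<ge> 1"
    by (simp add: m_def)
  have "iter X T (j + m - i) (iter X T i x) = iter X T j (iter X T m x)"
    using x by (simp flip: iter_add)
  then have "j + m - i \<in> return_times X T U"
    using i j unfolding return_times_def by force
  with pos show thesis
    by (intro that[of "nat (j + m - i)"]) auto
qed

end

text \<open>Makes the case \<open>r k = k\<close> an instance of the general statement.\<close>

lemma birkhoff_set_pos: "birkhoff_set (int ` {1..})"
  unfolding birkhoff_set_def
proof (intro conjI allI impI)
  fix X :: "real set" and d T U
  assume "minimal_system X d T" "openin (Metric_space.mtopology X d) U" "U \<noteq> {}"
  then obtain k :: nat where "k \<ge> 1" "int k \<in> return_times X T U"
    by (rule minimal_system.pos_return_time)
  then show "return_times X T U \<inter> int ` {1..} \<noteq> {}"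
    by auto
qed auto

section \<open>Transfer of systems to carriers in the reals\<close>

(* A point is determined by its distances to the points of one dense orbit, so X injects into the
   subsets of a countable set. *)
lemma (in minimal_system) inj_into_reals: "\<exists>f :: 'a \<Rightarrow> real. inj_on f X"
proof -
  obtain p where p: "p \<in> X" using nonempty by blast
  define code :: "'a \<Rightarrow> (int \<times> nat) set"
    where "code x = {(n, q). d x (iter X T n p) < 1 / Suc q}" for x
  have "inj_on code X"
  proof (rule inj_onI, rule ccontr)
    fix x y assume xy: "x \<in> X" "y \<in> X" "code x = code y" "x \<noteq> y"
    then have "d x y / 2 > 0" by simp
    \<comment> \<open>At this scale no orbit point can be within \<open>1 / Suc q\<close> of both
      \<open>x\<close> and \<open>y\<close>.\<close>
    then obtain q where q: "1 / Suc q < d x y / 2"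
      using nat_approx_posE by blast
    have "x \<in> mtopology closure_of range (\<lambda>n. iter X T n p)"
      using minimal p xy by simp
    then have "\<exists>y \<in> range (\<lambda>n. iter X T n p). y \<in> mball x (1 / Suc q)"
      unfolding metric_closure_of by simp
    then obtain n where n: "d x (iter X T n p) < 1 / Suc q"
      by auto
    then have "(n, q) \<in> code x"
      by (simp add: code_def)
    then have "d y (iter X T n p) < 1 / Suc q"
      unfolding xy(3) by (simp add: code_def)
    then show False
      using n q triangle[of x "iter X T n p" y] xy p by (simp add: commute)
  qed
  \<comment> \<open>Codes are sets of elements of a countable type, hence embed into
    \<open>nat set\<close>, which is equipotent with the reals.\<close>
  moreover have "inj (image (to_nat :: int \<times> nat \<Rightarrow> nat))"
    by (simp add: inj_on_def inj_image_eq_iff)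
  moreover obtain g :: "nat set \<Rightarrow> real" where "inj g"
    using nat_sets_eqpoll_reals unfolding eqpoll_def bij_betw_def by blast
  ultimately have "inj_on (g \<circ> (image to_nat \<circ> code)) X"
    by (metis comp_inj_on inj_on_subset subset_UNIV)
  then show ?thesis by blast
qed

text \<open>Transport of structure along an injection: \<open>d'\<close> turns \<open>f\<close> into
  an isometry onto its image and \<open>S\<close> is the conjugate of \<open>T\<close>. It is needed
  because \<open>birkhoff_set\<close> speaks only of carriers inside the reals.\<close>

locale system_transfer = minimal_system X d T
  for X :: "'a set" and d T +
  fixes f :: "'a \<Rightarrow> 'b"
  assumes inj: "inj_on f X"
begin

abbreviation g :: "'b \<Rightarrow> 'a" where "g \<equiv> inv_into X f"
abbreviation Y :: "'b set" where "Y \<equiv> f ` X"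
definition d' :: "'b \<Rightarrow> 'b \<Rightarrow> real" where "d' a b = d (g a) (g b)"
definition S :: "'b \<Rightarrow> 'b" where "S a = f (T (g a))"

lemma g_f [simp]: "x \<in> X \<Longrightarrow> g (f x) = x"
  by (simp add: inj)

sublocale Y: Metric_space Y d'
  by unfold_locales (auto simp: d'_def commute triangle)

lemma homeomorphic_maps_f: "homeomorphic_maps mtopology Y.mtopology f g"
  unfolding homeomorphic_maps_def
  by (auto simp: metric_continuous_map[OF Y.Metric_space_axioms]
      Y.metric_continuous_map[OF Metric_space_axioms] d'_def)

lemma homeomorphic_f: "homeomorphic_map mtopology Y.mtopology f"
  and homeomorphic_g: "homeomorphic_map Y.mtopology mtopology g"
  using homeomorphic_maps_f homeomorphic_maps_map by blast+

lemma S_eq: "S = f \<circ> T \<circ> g"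
  by (auto simp: S_def)

sublocale Y: dynamical_system Y d' S
proof
  show "Y \<noteq> {}"
    using nonempty by simp
  show "compact_space Y.mtopology"
    using compact homeomorphic_compact_space homeomorphic_f homeomorphic_map_imp_homeomorphic_space
    by blast
  show "homeomorphic_map Y.mtopology Y.mtopology S"
    unfolding S_eq
    by (intro homeomorphic_map_compose[OF homeomorphic_g] homeomorphic_map_compose[OF homeo]
        homeomorphic_f)
qed

lemma iter_f: "x \<in> X \<Longrightarrow> iter Y S n (f x) = f (iter X T n x)"
proof (induction n rule: int_induct[where k = 0])
  case (step1 n)
  then show ?case
    using Y.iter_succ[of "f x" n] iter_succ[of x n] by (metis S_def g_f imageI iter_in)
next
  case (step2 n)
  \<comment> \<open>For the backward step the identity is checked after applying \<open>S\<close>,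
    which is then cancelled on \<open>Y\<close>.\<close>
  then have "S (f (iter X T (n - 1) x)) = f (iter X T n x)"
    using iter_succ[of x "n - 1"] by (simp add: S_def)
  then show ?case
    using step2 by (metis Y.inv_T_T Y.iter_pred imageI iter_in)
qed simp

sublocale Y: minimal_system Y d' S
proof
  fix y assume "y \<in> Y"
  then obtain x where x: "x \<in> X" "y = f x" by blast
  then have "range (\<lambda>n. iter Y S n y) = f ` range (\<lambda>n. iter X T n x)"
    by (auto simp: iter_f)
  then show "Y.mtopology closure_of range (\<lambda>n. iter Y S n y) = Y"
    using homeomorphic_map_closure_of[OF homeomorphic_f, of "range (\<lambda>n. iter X T n x)"] x minimal
    by (auto simp: image_subset_iff)
qed

lemma return_times_f:
  assumes "U \<subseteq> X"
  shows "return_times Y S (f ` U) = return_times X T U"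
proof -
  have "iter Y S n ` f ` U \<inter> f ` U = f ` (iter X T n ` U \<inter> U)" for n
  proof -
    have "iter Y S n ` f ` U = f ` iter X T n ` U"
      using assms by (force simp: iter_f image_image intro!: image_cong)
    moreover have "iter X T n ` U \<subseteq> X"
      using assms by auto
    ultimately show ?thesis
      using inj_on_image_Int[OF inj] assms by simp
  qed
  then show ?thesis
    by (simp add: return_times_def)
qed

end

text \<open>Extends the defining property of Birkhoff sets to carriers of any type: a conjugate copy
  inside the reals is again minimal and has the same return times.\<close>

lemma (in minimal_system) birkhoff_return:
  assumes "birkhoff_set L" "openin mtopology U" "U \<noteq> {}"
  obtains l where "l \<in> L" "l \<in> return_times X T U"
proof -
  obtain f :: "'a \<Rightarrow> real" where "inj_on f X"
    using inj_into_reals by blast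
  then interpret system_transfer X d T f
    by unfold_locales
  have "openin Y.mtopology (f ` U)"
    using homeomorphic_map_openness_eq[OF homeomorphic_f] assms by blast
  then have "return_times Y S (f ` U) \<inter> L \<noteq> {}"
    using assms Y.minimal_system_axioms unfolding birkhoff_set_def by blast
  then show thesis
    using return_times_f openin_subset[OF assms(2)] that by auto
qed

section \<open>Moving recurrence\<close>

context minimal_system
begin

text \<open>By continuity, all points close enough to a fixed \<open>p\<close> follow its orbit
  within \<open>e / 2\<close> at the finitely many times in \<open>F\<close>.\<close>

lemma small_open_set:
  assumes "finite F" "e > 0"
  obtains V where "openin mtopology V" "V \<noteq> {}"
    "\<And>y z j. \<lbrakk>y \<in> V; z \<in> V; j \<in> F\<rbrakk> \<Longrightarrow> d (iter X T j y) (iter X T j z) < e"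
proof -
  obtain p where p: "p \<in> X" using nonempty by blast
  \<comment> \<open>The factor \<open>X\<close> keeps \<open>V\<close> inside the carrier when
    \<open>F\<close> is empty.\<close>
  define V where "V = X \<inter> (\<Inter>j\<in>F. {x \<in> X. iter X T j x \<in> mball (iter X T j p) (e / 2)})"
  show thesis
  proof (rule that)
    have "openin mtopology ((\<Inter>j\<in>F. {x \<in> X. iter X T j x \<in> mball (iter X T j p) (e / 2)}) \<inter> topspace mtopology)"
      using assms(1) openin_iter_vimage[OF openin_mball]
      by (rule openin_INT)
    then show "openin mtopology V"
      unfolding V_def by (simp add: Int_commute)
    show "V \<noteq> {}"
      using p assms by (auto simp: V_def)
    fix y z j assume "y \<in> V" "z \<in> V" "j \<in> F"
    then have "iter X T j y \<in> mball (iter X T j p) (e / 2)" "iter X T j z \<in> mball (iter X T j p) (e / 2)"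
      by (auto simp: V_def)
    then show "d (iter X T j y) (iter X T j z) < e"
      using triangle'[of "iter X T j y" "iter X T j p" "iter X T j z"] by (simp add: commute)
  qed
qed

text \<open>The order of choices matters: \<open>F\<close> depends only on \<open>U\<close>, so
  \<open>V\<close> is fixed before \<open>k\<close> is known, and the correction \<open>j\<close>
  stays in \<open>F\<close> however large \<open>n k\<close> is.\<close>

lemma near_return_in_open:
  assumes r: "birkhoff_set (r ` {1..})" and U: "openin mtopology U" "U \<noteq> {}" and "e > 0"
  obtains x k where "x \<in> U" "k \<ge> (1::nat)" "d (iter X T (n k + r k) x) (iter X T (n k) x) < e"
proof -
  obtain F where F: "finite F" "\<And>x. x \<in> X \<Longrightarrow> \<exists>j\<in>F. iter X T j x \<in> U"
    using finite_visit_times[OF U] by blast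
  obtain V where V: "openin mtopology V" "V \<noteq> {}"
    and small: "\<And>y z j. \<lbrakk>y \<in> V; z \<in> V; j \<in> F\<rbrakk> \<Longrightarrow> d (iter X T j y) (iter X T j z) < e"
    using small_open_set[OF F(1) \<open>e > 0\<close>] by blast
  obtain k where k: "k \<ge> 1" and "r k \<in> return_times X T V"
    using birkhoff_return[OF r V] by (metis atLeast_iff imageE)
  then obtain y where y: "y \<in> V" "iter X T (r k) y \<in> V"
    unfolding return_times_def by blast
  have "y \<in> X"
    using y openin_subset[OF V(1)] by auto
  then obtain j where j: "j \<in> F" "iter X T j (iter X T (- n k) y) \<in> U"
    using F by (meson iter_in)
  \<comment> \<open>The shift by \<open>- n k\<close> cancels the moving time: the two iterates to
    compare become the time \<open>j\<close> images of \<open>y\<close> and of its return, both in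
    \<open>V\<close>.\<close>
  let ?x = "iter X T (j - n k) y"
  have "iter X T (n k) ?x = iter X T j y"
    and "iter X T (n k + r k) ?x = iter X T j (iter X T (r k) y)"
    and "?x = iter X T j (iter X T (- n k) y)"
    using \<open>y \<in> X\<close> by (simp_all add: algebra_simps flip: iter_add)
  then show thesis
    using that[of ?x k] j(2) k small[OF y(2,1) j(1)] by simp
qed

text \<open>A nonnegative infimum vanishes iff it lies below every \<open>1 / Suc m\<close>, and it
  lies strictly below a bound iff one of its terms does.\<close>

lemma moving_recurrent2_eq:
  "moving_recurrent2 X d T n r =
    (\<Inter>m::nat. {x \<in> X. \<exists>k\<ge>1. d (iter X T (n k + r k) x) (iter X T (n k) x) < 1 / Suc m})"
proof -
  have "psi2 X d T n r x = 0 \<longleftrightarrow>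
      (\<forall>m::nat. \<exists>k\<ge>1. d (iter X T (n k + r k) x) (iter X T (n k) x) < 1 / Suc m)" for x
  proof -
    let ?h = "\<lambda>k. d (iter X T (n k + r k) x) (iter X T (n k) x)"
    have bdd: "bdd_below (?h ` {1..})"
      by (rule bdd_belowI[of _ 0]) auto
    have nonneg: "psi2 X d T n r x \<ge> 0"
      unfolding psi2_def by (rule cINF_greatest) auto
    have less_iff: "psi2 X d T n r x < e \<longleftrightarrow> (\<exists>k\<ge>1. ?h k < e)" for e
      unfolding psi2_def using bdd by (subst cINF_less_iff) auto
    show ?thesis
      unfolding less_iff[symmetric]
    proof
      assume R: "\<forall>m::nat. psi2 X d T n r x < 1 / Suc m"
      show "psi2 X d T n r x = 0"
        using nonneg R nat_approx_posE by (metis less_eq_real_def less_asym)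
    qed simp
  qed
  then show ?thesis
    by (auto simp: moving_recurrent2_def)
qed

lemma dense_gdelta_moving_recurrent2:
  assumes "birkhoff_set (r ` {1..})"
  shows "dense_gdelta mtopology (moving_recurrent2 X d T n r)"
proof -
  define A where "A m = {x \<in> X. \<exists>k\<ge>1. d (iter X T (n k + r k) x) (iter X T (n k) x) < 1 / Suc m}"
    for m
  have open_A: "openin mtopology (A m)" for m
  proof -
    have "A m = (\<Union>k\<in>{1..}. {x \<in> X. d (iter X T (n k + r k) x) (iter X T (n k) x) < 1 / Suc m})"
      by (auto simp: A_def)
    then show ?thesis
      using openin_dist_less by auto
  qed
  have "mtopology closure_of A m = X" for m
  proof -
    have "U \<inter> A m \<noteq> {}" if U: "openin mtopology U" "U \<noteq> {}" for U
    proof -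
      obtain x k where "x \<in> U" "k \<ge> 1" "d (iter X T (n k + r k) x) (iter X T (n k) x) < 1 / Suc m"
        by (rule near_return_in_open[OF assms U, of "1 / Suc m" n]) auto
      then show ?thesis
        using openin_subset[OF U(1)] by (auto simp: A_def)
    qed
    then show ?thesis
      using dense_intersects_open[of mtopology "A m"] by (auto simp: Int_commute)
  qed
  \<comment> \<open>Compactness gives the completeness that the Baire category theorem
    requires.\<close>
  then have "mtopology closure_of \<Inter>(range A) = X"
    using open_A compact compact_space_imp_mcomplete
    by (intro metric_Baire_category) auto
  moreover have "gdelta_in mtopology (\<Inter>(range A))"
    by (intro gdelta_in_Inter) (auto intro: open_imp_gdelta_in open_A)
  ultimately show ?thesis
    unfolding dense_gdelta_def moving_recurrent2_eq A_def by simp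
qed

end

theorem theorem6p4:
  shows "(\<forall>r :: nat \<Rightarrow> int. (\<forall>k\<ge>1. r k \<noteq> 0) \<longrightarrow> birkhoff_set (r ` {1..}) \<longrightarrow>
            (\<forall>(n :: nat \<Rightarrow> int) (X :: 'a set) d T. minimal_system X d T \<longrightarrow>
               dense_gdelta (Metric_space.mtopology X d) (moving_recurrent2 X d T n r)))
       \<and> (\<forall>(n :: nat \<Rightarrow> int) (X :: 'a set) d T. minimal_system X d T \<longrightarrow>
               dense_gdelta (Metric_space.mtopology X d) (moving_recurrent X d T n))"
proof -
  have "moving_recurrent X d T n = moving_recurrent2 X d T n int"
    for X :: "'a set" and d T n
    by (simp add: moving_recurrent_def moving_recurrent2_def psi_def psi2_def)
  then show ?thesis
    using minimal_system.dense_gdelta_moving_recurrent2 birkhoff_set_pos by auto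
qed

end
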